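(* Let $\Lambda$ be a set of Sahlqvist formulas, and for each $\lambda\in\Lambda$ let $\alpha_\lambda$ be a first-order frame correspondent of $\lambda$ (a first-order sentence in the language with equality, binary predicates $\le,R$ and constant $\mathfrak{ff}$ such that for every CK-frame $\mathcal{X}$, $\mathcal{X}\Vdash\lambda$ iff $\mathcal{X}$, with $\mathfrak{ff}$ interpreted as $\text{bomb}$, satisfies $\alpha_\lambda$). Let $\mathsf{K}$ be the class of CK-frames satisfying $\alpha_\lambda$ for all $\lambda\in\Lambda$. Then the logic $\mathsf{CK}\oplus\Lambda$ is complete with respect to $\mathsf{K}$: if $\mathcal{X}\Vdash\phi$ for every $\mathcal{X}\in\mathsf{K}$, then $\phi$ is a theorem of $\mathsf{CK}\oplus\Lambda$.
   Context: Formulas: for a set $\mathrm{Prop}$ of propositional variables, $\phi::=p\mid\bot\mid\phi\wedge\phi\mid\phi\vee\phi\mid\phi\to\phi\mid\Box\phi\mid\Diamond\phi$, with $\top:=\bot\to\bot$. The logic $\mathsf{CK}$ is axiomatized by all substitution instances of the axioms of intuitionistic propositional logic together with $\Box(\phi\to\psi)\to(\Box\phi\to\Box\psi)$ and $\Box(\phi\to\psi)\to(\Diamond\phi\to\Diamond\psi)$, closed under modus ponens and necessitation (from a theorem $\phi$ infer $\Box\phi$). $\mathsf{CK}\oplus\Lambda$ additionally has all substitution instances of formulas in $\Lambda$ as axioms. A CK-frame is $(X,\text{bomb},\le,R)$ where $\le$ is a preorder on $X$, $\text{bomb}\in X$ is $\le$-maximal, and $R\subseteq X\times X$ satisfies: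 $\text{bomb}\,R\,x$ iff $x=\text{bomb}$. $\mathrm{Up}(X)$ is the set of $\le$-upsets containing $\text{bomb}$. A valuation is $V:\mathrm{Prop}\to\mathrm{Up}(X)$, extended by $V(\bot)=\{\text{bomb}\}$, $V(\wedge)=\cap$, $V(\vee)=\cup$, $V(\phi\to\psi)=\{x:\forall y(x\le y,\ y\in V(\phi)\Rightarrow y\in V(\psi))\}$, $V(\Box\phi)=\{x:\forall y,z(x\le y\,R\,z\Rightarrow z\in V(\phi))\}$, $V(\Diamond\phi)=\{x:\forall y(x\le y\Rightarrow\exists z(yRz,\ z\in V(\phi)))\}$. $\mathcal{X}\Vdash\phi$ means $V(\phi)=X$ for every valuation $V$. A formula is positive if built from variables, $\top,\bot,\wedge,\vee,\Box,\Diamond$. A boxed atom is $\Box^n p$ ($n\ge0$). A Sahlqvist antecedent is built from boxed atoms using $\top,\bot,\wedge,\vee$. A Sahlqvist formula is $\phi\to\psi$ with $\phi$ a Sahlqvist antecedent and $\psi$ positive. *)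

theory Defs
  imports Main
begin

section \<open>Formulas and the logic\<close>

text \<open>The type parameter plays the role of the set of propositional variables.\<close>

datatype 'p form =
    Atom 'p
  | Bot
  | And "'p form" "'p form"
  | Or "'p form" "'p form"
  | Imp "'p form" "'p form"
  | Box "'p form"
  | Dia "'p form"

abbreviation Top :: "'p form" where
  "Top \<equiv> Imp Bot Bot"

primrec subst :: "('p \<Rightarrow> 'p form) \<Rightarrow> 'p form \<Rightarrow> 'p form" where
  "subst s (Atom p) = s p"
| "subst s Bot = Bot"
| "subst s (And a b) = And (subst s a) (subst s b)"
| "subst s (Or a b) = Or (subst s a) (subst s b)"
| "subst s (Imp a b) = Imp (subst s a) (subst s b)"
| "subst s (Box a) = Box (subst s a)"
| "subst s (Dia a) = Dia (subst s a)"

text \<open>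
  The axioms of intuitionistic propositional logic are given as schemata over all modal
  formulas, so that the set is closed under substitution whatever the number of variables.
\<close>

inductive ipc_axiom :: "'p form \<Rightarrow> bool" where
  K: "ipc_axiom (Imp a (Imp b a))"
| S: "ipc_axiom (Imp (Imp a (Imp b c)) (Imp (Imp a b) (Imp a c)))"
| AndE1: "ipc_axiom (Imp (And a b) a)"
| AndE2: "ipc_axiom (Imp (And a b) b)"
| AndI: "ipc_axiom (Imp a (Imp b (And a b)))"
| OrI1: "ipc_axiom (Imp a (Or a b))"
| OrI2: "ipc_axiom (Imp b (Or a b))"
| OrE: "ipc_axiom (Imp (Imp a c) (Imp (Imp b c) (Imp (Or a b) c)))"
| BotE: "ipc_axiom (Imp Bot a)"

text \<open>\<open>CK_theorem \<Lambda> \<phi>\<close> says that \<open>\<phi>\<close> is a theorem of \<open>CK \<oplus> \<Lambda>\<close>.\<close>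

inductive CK_theorem :: "'p form set \<Rightarrow> 'p form \<Rightarrow> bool" for \<Lambda> where
  IPC: "ipc_axiom a \<Longrightarrow> CK_theorem \<Lambda> a"
| KBox: "CK_theorem \<Lambda> (Imp (Box (Imp a b)) (Imp (Box a) (Box b)))"
| KDia: "CK_theorem \<Lambda> (Imp (Box (Imp a b)) (Imp (Dia a) (Dia b)))"
| Ax: "l \<in> \<Lambda> \<Longrightarrow> CK_theorem \<Lambda> (subst s l)"
| MP: "CK_theorem \<Lambda> (Imp a b) \<Longrightarrow> CK_theorem \<Lambda> a \<Longrightarrow> CK_theorem \<Lambda> b"
| Nec: "CK_theorem \<Lambda> a \<Longrightarrow> CK_theorem \<Lambda> (Box a)"


section \<open>Sahlqvist formulas\<close>

inductive positive :: "'p form \<Rightarrow> bool" where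
  "positive (Atom p)"
| "positive Top"
| "positive Bot"
| "positive a \<Longrightarrow> positive b \<Longrightarrow> positive (And a b)"
| "positive a \<Longrightarrow> positive b \<Longrightarrow> positive (Or a b)"
| "positive a \<Longrightarrow> positive (Box a)"
| "positive a \<Longrightarrow> positive (Dia a)"

inductive sahlqvist_antecedent :: "'p form \<Rightarrow> bool" where
  boxed_atom: "sahlqvist_antecedent ((Box ^^ n) (Atom p))"
| "sahlqvist_antecedent Top"
| "sahlqvist_antecedent Bot"
| "sahlqvist_antecedent a \<Longrightarrow> sahlqvist_antecedent b \<Longrightarrow> sahlqvist_antecedent (And a b)"
| "sahlqvist_antecedent a \<Longrightarrow> sahlqvist_antecedent b \<Longrightarrow> sahlqvist_antecedent (Or a b)"

definition sahlqvist :: "'p form \<Rightarrow> bool" where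
  "sahlqvist l \<longleftrightarrow> (\<exists>a b. l = Imp a b \<and> sahlqvist_antecedent a \<and> positive b)"


section \<open>CK-frames\<close>

record 'w frame =
  worlds :: "'w set"
  bomb :: 'w
  leq :: "'w rel"
  acc :: "'w rel"

text \<open>
  Maximality of the bomb is required in the strict sense that nothing else lies above it, even
  though \<open>leq\<close> is only a preorder: this is what makes the truth set of \<open>Bot\<close> an upset.
\<close>

definition CK_frame :: "'w frame \<Rightarrow> bool" where
  "CK_frame X \<longleftrightarrow>
     preorder_on (worlds X) (leq X) \<and>
     bomb X \<in> worlds X \<and>
     (\<forall>x. (bomb X, x) \<in> leq X \<longrightarrow> x = bomb X) \<and>
     acc X \<subseteq> worlds X \<times> worlds X \<and>
     (\<forall>x. (bomb X, x) \<in> acc X \<longleftrightarrow> x = bomb X)"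

definition Up :: "'w frame \<Rightarrow> 'w set set" where
  "Up X = {A. A \<subseteq> worlds X \<and> bomb X \<in> A \<and> (\<forall>x y. x \<in> A \<longrightarrow> (x, y) \<in> leq X \<longrightarrow> y \<in> A)}"

definition valuation :: "'w frame \<Rightarrow> ('p \<Rightarrow> 'w set) \<Rightarrow> bool" where
  "valuation X V \<longleftrightarrow> (\<forall>p. V p \<in> Up X)"

primrec truth :: "'w frame \<Rightarrow> ('p \<Rightarrow> 'w set) \<Rightarrow> 'p form \<Rightarrow> 'w set" where
  "truth X V (Atom p) = V p"
| "truth X V Bot = {bomb X}"
| "truth X V (And a b) = truth X V a \<inter> truth X V b"
| "truth X V (Or a b) = truth X V a \<union> truth X V b"
| "truth X V (Imp a b) =
     {x \<in> worlds X. \<forall>y. (x, y) \<in> leq X \<and> y \<in> truth X V a \<longrightarrow> y \<in> truth X V b}"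
| "truth X V (Box a) =
     {x \<in> worlds X. \<forall>y z. (x, y) \<in> leq X \<and> (y, z) \<in> acc X \<longrightarrow> z \<in> truth X V a}"
| "truth X V (Dia a) =
     {x \<in> worlds X. \<forall>y. (x, y) \<in> leq X \<longrightarrow> (\<exists>z. (y, z) \<in> acc X \<and> z \<in> truth X V a)}"

definition valid :: "'w frame \<Rightarrow> 'p form \<Rightarrow> bool" where
  "valid X a \<longleftrightarrow> (\<forall>V. valuation X V \<longrightarrow> truth X V a = worlds X)"


section \<open>First-order frame correspondents\<close>

datatype fo_term = FVar nat | FBomb

datatype fo_form =
    FEq fo_term fo_term
  | FLeq fo_term fo_term
  | FAcc fo_term fo_term
  | FFalse
  | FAnd fo_form fo_form
  | FOr fo_form fo_form
  | FImp fo_form fo_form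
  | FAll nat fo_form
  | FEx nat fo_form

primrec term_vars :: "fo_term \<Rightarrow> nat set" where
  "term_vars (FVar i) = {i}"
| "term_vars FBomb = {}"

primrec free_vars :: "fo_form \<Rightarrow> nat set" where
  "free_vars (FEq s t) = term_vars s \<union> term_vars t"
| "free_vars (FLeq s t) = term_vars s \<union> term_vars t"
| "free_vars (FAcc s t) = term_vars s \<union> term_vars t"
| "free_vars FFalse = {}"
| "free_vars (FAnd a b) = free_vars a \<union> free_vars b"
| "free_vars (FOr a b) = free_vars a \<union> free_vars b"
| "free_vars (FImp a b) = free_vars a \<union> free_vars b"
| "free_vars (FAll i a) = free_vars a - {i}"
| "free_vars (FEx i a) = free_vars a - {i}"

primrec fo_val :: "'w frame \<Rightarrow> (nat \<Rightarrow> 'w) \<Rightarrow> fo_term \<Rightarrow> 'w" where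
  "fo_val X e (FVar i) = e i"
| "fo_val X e FBomb = bomb X"

primrec fo_sat :: "'w frame \<Rightarrow> (nat \<Rightarrow> 'w) \<Rightarrow> fo_form \<Rightarrow> bool" where
  "fo_sat X e (FEq s t) \<longleftrightarrow> fo_val X e s = fo_val X e t"
| "fo_sat X e (FLeq s t) \<longleftrightarrow> (fo_val X e s, fo_val X e t) \<in> leq X"
| "fo_sat X e (FAcc s t) \<longleftrightarrow> (fo_val X e s, fo_val X e t) \<in> acc X"
| "fo_sat X e FFalse \<longleftrightarrow> False"
| "fo_sat X e (FAnd a b) \<longleftrightarrow> fo_sat X e a \<and> fo_sat X e b"
| "fo_sat X e (FOr a b) \<longleftrightarrow> fo_sat X e a \<or> fo_sat X e b"
| "fo_sat X e (FImp a b) \<longleftrightarrow> (fo_sat X e a \<longrightarrow> fo_sat X e b)"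
| "fo_sat X e (FAll i a) \<longleftrightarrow> (\<forall>w\<in>worlds X. fo_sat X (e(i := w)) a)"
| "fo_sat X e (FEx i a) \<longleftrightarrow> (\<exists>w\<in>worlds X. fo_sat X (e(i := w)) a)"

definition satisfies :: "'w frame \<Rightarrow> fo_form \<Rightarrow> bool" where
  "satisfies X a \<longleftrightarrow> (\<forall>e. range e \<subseteq> worlds X \<longrightarrow> fo_sat X e a)"

text \<open>
  HOL cannot quantify over types inside a formula. The first argument fixes a universe \<open>'w\<close>
  from which the worlds of the frames are taken; any subset of it may carry a frame.
\<close>

definition fo_correspondent :: "'w itself \<Rightarrow> 'p form \<Rightarrow> fo_form \<Rightarrow> bool" where
  "fo_correspondent _ l a \<longleftrightarrow>
     free_vars a = {} \<and>
     (\<forall>X :: 'w frame. CK_frame X \<longrightarrow> (valid X l \<longleftrightarrow> satisfies X a))"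

text \<open>
  The universe must not be too small: with \<open>'w\<close> a one-element type the only CK-frame is the
  bomb alone, which validates everything. A universe into which the sets of sets of
  formulas embed suffices; the type \<open>'p form set set\<close> itself is one.
\<close>

definition large_universe :: "'w itself \<Rightarrow> 'p itself \<Rightarrow> bool" where
  "large_universe _ _ \<longleftrightarrow> (\<exists>f :: 'p form set set \<Rightarrow> 'w. inj f)"

end

theory Submission
  imports Defs
begin

text \<open>
  Completeness is proved with a canonical frame whose worlds are pairs of a prime theory \<open>G\<close>
  (possibly the inconsistent one, which is the bomb) and an optional formula \<open>a\<close> with \<open>Dia a\<close> not
  in \<open>G\<close>; the successors of such a world are the prime theories that contain the unboxing of \<open>G\<close>
  and omit \<open>a\<close>. One omitted formula is enough to refute diamonds, and it keeps each set of
  successors compact, which would fail for arbitrary sets of successors.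

  Sahlqvist formulas are canonical: if a Sahlqvist antecedent holds at a world under an arbitrary
  valuation, it already holds under a smaller one that maps each variable to a closed set, that
  is, to the set of worlds whose theory contains a given theory \<open>T p\<close>. By compactness a positive
  formula holds under a closed valuation as soon as all its instances by substitutions \<open>s\<close> with
  \<open>s p \<in> T p\<close> belong to the theory of the world, and the positive consequent is monotone in the
  valuation.
\<close>

section \<open>Theories\<close>

text \<open>Closure under necessitation is left out: a theory describes a single world, where
  \<open>a\<close> may hold without \<open>Box a\<close>.\<close>

definition closed_theory :: "'p form set \<Rightarrow> 'p form set \<Rightarrow> bool" where
  "closed_theory \<Lambda> T \<longleftrightarrow>
     (\<forall>a. CK_theorem \<Lambda> a \<longrightarrow> a \<in> T) \<and> (\<forall>a b. Imp a b \<in> T \<longrightarrow> a \<in> T \<longrightarrow> b \<in> T)"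

definition prime_theory :: "'p form set \<Rightarrow> 'p form set \<Rightarrow> bool" where
  "prime_theory \<Lambda> T \<longleftrightarrow> closed_theory \<Lambda> T \<and> (\<forall>a b. Or a b \<in> T \<longrightarrow> a \<in> T \<or> b \<in> T)"

lemma prime_theory_closed: "prime_theory \<Lambda> T \<Longrightarrow> closed_theory \<Lambda> T"
  by (simp add: prime_theory_def)

lemma prime_theory_UNIV: "prime_theory \<Lambda> UNIV"
  by (simp add: prime_theory_def closed_theory_def)

lemma closed_theory_UNIV: "closed_theory \<Lambda> UNIV"
  by (simp add: closed_theory_def)

lemma closed_theory_theorems: "closed_theory \<Lambda> {a. CK_theorem \<Lambda> a}"
  by (auto simp: closed_theory_def intro: MP)

lemma closed_theory_Int: "closed_theory \<Lambda> S \<Longrightarrow> closed_theory \<Lambda> T \<Longrightarrow> closed_theory \<Lambda> (S \<inter> T)"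
  by (auto simp: closed_theory_def)

section \<open>Derivations inside a closed theory\<close>

context
  fixes \<Lambda> T :: "'p form set"
  assumes T: "closed_theory \<Lambda> T"
begin

lemma thm_in: "CK_theorem \<Lambda> a \<Longrightarrow> a \<in> T"
  using T by (simp add: closed_theory_def)

lemma mp_in: "Imp a b \<in> T \<Longrightarrow> a \<in> T \<Longrightarrow> b \<in> T"
  using T by (auto simp: closed_theory_def)

lemma ipc_in: "ipc_axiom a \<Longrightarrow> a \<in> T"
  by (intro thm_in IPC)

lemma imp_const_in: "b \<in> T \<Longrightarrow> Imp a b \<in> T"
  by (rule mp_in[OF ipc_in[OF ipc_axiom.K]])

lemma imp_refl_in: "Imp a a \<in> T"
  using mp_in[OF mp_in[OF ipc_in[OF ipc_axiom.S]] ipc_in[OF ipc_axiom.K]] ipc_in[OF ipc_axiom.K]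
  by blast

text \<open>This is the least closed theory that contains \<open>T\<close> and \<open>a\<close>; the
  axiom \<open>S\<close> makes it closed under modus ponens.\<close>

lemma closed_theory_extend: "closed_theory \<Lambda> {b. Imp a b \<in> T}"
  unfolding closed_theory_def
  using mp_in[OF mp_in[OF ipc_in[OF ipc_axiom.S]]] imp_const_in thm_in by blast

text \<open>A semantic form of the deduction theorem, obtained by taking \<open>S\<close> to be
  \<open>{b. Imp a b \<in> T}\<close>.\<close>

lemma imp_in:
  assumes "\<And>S. closed_theory \<Lambda> S \<Longrightarrow> T \<subseteq> S \<Longrightarrow> a \<in> S \<Longrightarrow> b \<in> S"
  shows "Imp a b \<in> T"
  using assms[OF closed_theory_extend[of a]] imp_const_in imp_refl_in by blast

lemma and_in_iff: "And a b \<in> T \<longleftrightarrow> a \<in> T \<and> b \<in> T"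
  using mp_in[OF ipc_in[OF AndE1]] mp_in[OF ipc_in[OF AndE2]]
    mp_in[OF mp_in[OF ipc_in[OF AndI]]] by blast

lemma or_in: "a \<in> T \<or> b \<in> T \<Longrightarrow> Or a b \<in> T"
  using mp_in[OF ipc_in[OF OrI1]] mp_in[OF ipc_in[OF OrI2]] by blast

lemma or_elim_in: "Or a b \<in> T \<Longrightarrow> Imp a c \<in> T \<Longrightarrow> Imp b c \<in> T \<Longrightarrow> c \<in> T"
  using mp_in[OF mp_in[OF mp_in[OF ipc_in[OF OrE]]]] by blast

lemma imp_trans_in: "Imp a b \<in> T \<Longrightarrow> Imp b c \<in> T \<Longrightarrow> Imp a c \<in> T"
  using mp_in[OF mp_in[OF ipc_in[OF ipc_axiom.S]]] imp_const_in by blast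

lemma or_mono_in: "Or a b \<in> T \<Longrightarrow> Imp a c \<in> T \<Longrightarrow> Imp b d \<in> T \<Longrightarrow> Or c d \<in> T"
  using or_elim_in imp_trans_in ipc_in[OF OrI1] ipc_in[OF OrI2] by blast

lemma bot_in_iff: "Bot \<in> T \<longleftrightarrow> T = UNIV"
  using mp_in[OF ipc_in[OF BotE]] by blast

lemma closed_theory_unbox: "closed_theory \<Lambda> {a. Box a \<in> T}"
  unfolding closed_theory_def
  using mp_in[OF mp_in[OF thm_in[OF KBox]]] thm_in[OF Nec] by blast

lemma dia_mono_in: "Box (Imp a b) \<in> T \<Longrightarrow> Dia a \<in> T \<Longrightarrow> Dia b \<in> T"
  using mp_in[OF mp_in[OF thm_in[OF KDia]]] by blast

end

text \<open>The theorems form the least closed theory, so arguing inside an arbitrary closed theory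
  replaces Hilbert-style derivations.\<close>

lemma CK_theorem_impI:
  assumes "\<And>T. closed_theory \<Lambda> T \<Longrightarrow> a \<in> T \<Longrightarrow> b \<in> T"
  shows "CK_theorem \<Lambda> (Imp a b)"
  using imp_in[OF closed_theory_theorems[of \<Lambda>]] assms by blast

lemma closed_theory_unbox_pow:
  "closed_theory \<Lambda> T \<Longrightarrow> closed_theory \<Lambda> {a. (Box ^^ n) a \<in> T}"
proof (induction n arbitrary: T)
  case (Suc n)
  show ?case using Suc.IH[OF closed_theory_unbox[OF Suc.prems]] by simp
qed simp

lemma box_pow_mono:
  assumes "CK_theorem \<Lambda> (Imp a b)"
  shows "CK_theorem \<Lambda> (Imp ((Box ^^ n) a) ((Box ^^ n) b))"
proof (rule CK_theorem_impI)
  fix T assume T: "closed_theory \<Lambda> T" and a: "(Box ^^ n) a \<in> T"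
  have B: "closed_theory \<Lambda> {a. (Box ^^ n) a \<in> T}" by (rule closed_theory_unbox_pow[OF T])
  show "(Box ^^ n) b \<in> T" using mp_in[OF B, of a b] thm_in[OF B assms] a by simp
qed

text \<open>The induction ranges over all closed theories so that the box case can pass to the
  unboxing of \<open>T\<close>. Assuming theorems rather than members of \<open>T\<close> makes
  \<open>s p\<close> imply \<open>t p\<close> in all these theories; in the diamond case the
  implication between the two instances is then itself a theorem and can be necessitated.\<close>

lemma subst_mono_positive:
  assumes "positive a" and "\<And>p. CK_theorem \<Lambda> (Imp (s p) (t p))"
    and "closed_theory \<Lambda> T" and "subst s a \<in> T"
  shows "subst t a \<in> T"
  using assms(1,3,4)
proof (induction a arbitrary: T rule: positive.induct)
  case (1 p)
  then show ?case using mp_in[OF 1(1) thm_in[OF 1(1) assms(2)]] by simp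
next
  case (4 a b)
  then show ?case by (simp add: and_in_iff)
next
  case (5 a b)
  have "Imp (subst s a) (subst t a) \<in> T" "Imp (subst s b) (subst t b) \<in> T"
    using imp_in[OF 5(5)] 5(3,4) by blast+
  then show ?case using or_mono_in[OF 5(5)] 5(6) by simp
next
  case (6 a)
  then show ?case using 6(2)[OF closed_theory_unbox[OF 6(3)]] by simp
next
  case (7 a)
  have "CK_theorem \<Lambda> (Imp (subst s a) (subst t a))"
    using CK_theorem_impI 7(2) by blast
  then have "Box (Imp (subst s a) (subst t a)) \<in> T" by (intro thm_in[OF 7(3)] Nec)
  then show ?case using dia_mono_in[OF 7(3)] 7(4) by simp
qed auto

text \<open>Zorn's lemma. Directedness lets \<open>I\<close> act as an ideal: if both disjuncts of a
  member of the maximal theory imply members of \<open>I\<close>, an upper bound \<open>c\<close> of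
  these two follows from the disjunction. Omitting a whole set instead of one formula is needed for
  boxed atoms.\<close>

lemma prime_extension:
  assumes T: "closed_theory \<Lambda> T" and disj: "T \<inter> I = {}"
    and dir: "\<And>a b. a \<in> I \<Longrightarrow> b \<in> I \<Longrightarrow>
      \<exists>c\<in>I. CK_theorem \<Lambda> (Imp a c) \<and> CK_theorem \<Lambda> (Imp b c)"
  obtains P where "prime_theory \<Lambda> P" "T \<subseteq> P" "P \<inter> I = {}"
proof -
  let ?A = "{S. closed_theory \<Lambda> S \<and> T \<subseteq> S \<and> S \<inter> I = {}}"
  have "\<exists>M\<in>?A. \<forall>S\<in>?A. M \<subseteq> S \<longrightarrow> S = M"
  proof (rule subset_Zorn_nonempty)
    show "?A \<noteq> {}" using T disj by blast
    fix \<C> assume C: "\<C> \<noteq> {}" "subset.chain ?A \<C>"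
    then have sub: "\<C> \<subseteq> ?A" and tot: "\<And>S S'. S \<in> \<C> \<Longrightarrow> S' \<in> \<C> \<Longrightarrow> S \<subseteq> S' \<or> S' \<subseteq> S"
      by (auto simp: subset_chain_def)
    have "closed_theory \<Lambda> (\<Union>\<C>)"
      unfolding closed_theory_def
    proof (intro conjI allI impI)
      fix a assume "CK_theorem \<Lambda> a"
      then show "a \<in> \<Union>\<C>" using C(1) sub thm_in by blast
    next
      fix a b assume "Imp a b \<in> \<Union>\<C>" "a \<in> \<Union>\<C>"
      then obtain S where S: "S \<in> \<C>" "Imp a b \<in> S" "a \<in> S" using tot by blast
      then have "closed_theory \<Lambda> S" using sub by blast
      from mp_in[OF this S(2,3)] S(1) show "b \<in> \<Union>\<C>" by blast
    qed
    then show "\<Union>\<C> \<in> ?A" using C(1) sub by blast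
  qed
  then obtain M where "M \<in> ?A" and "\<forall>S\<in>?A. M \<subseteq> S \<longrightarrow> S = M" by (elim bexE)
  then have M: "closed_theory \<Lambda> M" "T \<subseteq> M" "M \<inter> I = {}"
    and max: "\<And>S. S \<in> ?A \<Longrightarrow> M \<subseteq> S \<Longrightarrow> S = M" by simp_all
  \<comment> \<open>Adjoining \<open>a\<close> to \<open>M\<close> gives a closed theory, which by
    maximality meets \<open>I\<close>.\<close>
  have meets: "\<exists>i\<in>I. Imp a i \<in> M" if "a \<notin> M" for a
  proof (rule ccontr)
    assume no: "\<not> (\<exists>i\<in>I. Imp a i \<in> M)"
    let ?E = "{b. Imp a b \<in> M}"
    have "M \<subseteq> ?E" using imp_const_in[OF M(1)] by blast
    moreover have "closed_theory \<Lambda> ?E" by (rule closed_theory_extend[OF M(1)])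
    ultimately have "?E = M" using no M(2) by (intro max) auto
    then show False using imp_refl_in[OF M(1), of a] that by blast
  qed
  have "a \<in> M \<or> b \<in> M" if ab: "Or a b \<in> M" for a b
  proof (rule ccontr)
    assume "\<not> (a \<in> M \<or> b \<in> M)"
    then obtain i j where ij: "i \<in> I" "Imp a i \<in> M" "j \<in> I" "Imp b j \<in> M"
      using meets by blast
    then obtain c where c: "c \<in> I" "CK_theorem \<Lambda> (Imp i c)" "CK_theorem \<Lambda> (Imp j c)"
      using dir by blast
    have "Or i j \<in> M" by (rule or_mono_in[OF M(1) ab ij(2,4)])
    then have "c \<in> M" using or_elim_in[OF M(1)] thm_in[OF M(1)] c(2,3) by blast
    then show False using c(1) M(3) by blast
  qed
  then have "prime_theory \<Lambda> M" using M(1) by (simp add: prime_theory_def)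
  then show ?thesis using M(2,3) by (rule that)
qed

corollary prime_extension_omit:
  assumes "closed_theory \<Lambda> T" and "a \<notin> T"
  obtains P where "prime_theory \<Lambda> P" "T \<subseteq> P" "a \<notin> P"
proof (rule prime_extension[of \<Lambda> T "{a}"])
  show "\<exists>c\<in>{a}. CK_theorem \<Lambda> (Imp b c) \<and> CK_theorem \<Lambda> (Imp b' c)"
    if "b \<in> {a}" "b' \<in> {a}" for b b'
    using that CK_theorem_impI[of \<Lambda> a a] by auto
qed (use assms that in auto)


section \<open>The canonical frame\<close>

type_synonym 'p point = "'p form set \<times> 'p form option"

definition points :: "'p form set \<Rightarrow> 'p point set" where
  "points \<Lambda> = {(G, m). prime_theory \<Lambda> G \<and> (\<forall>a. m = Some a \<longrightarrow> Dia a \<notin> G)}"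

text \<open>The order ignores the omitted formulas, so it is only a preorder: all points with the
  same theory lie above each other, and each of them constrains its successors in its own
  way.\<close>

definition canonical :: "'p form set \<Rightarrow> 'p point frame" where
  "canonical \<Lambda> = \<lparr>worlds = points \<Lambda>, bomb = (UNIV, None),
     leq = {(x, y). x \<in> points \<Lambda> \<and> y \<in> points \<Lambda> \<and> fst x \<subseteq> fst y},
     acc = {(x, y). x \<in> points \<Lambda> \<and> y \<in> points \<Lambda> \<and> {a. Box a \<in> fst x} \<subseteq> fst y \<and>
              (\<forall>a. snd x = Some a \<longrightarrow> a \<notin> fst y)}\<rparr>"

lemma canonical_simps [simp]:
  "worlds (canonical \<Lambda>) = points \<Lambda>"
  "bomb (canonical \<Lambda>) = (UNIV, None)"
  "(x, y) \<in> leq (canonical \<Lambda>) \<longleftrightarrow> x \<in> points \<Lambda> \<and> y \<in> points \<Lambda> \<and> fst x \<subseteq> fst y"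
  "(x, y) \<in> acc (canonical \<Lambda>) \<longleftrightarrow> x \<in> points \<Lambda> \<and> y \<in> points \<Lambda> \<and>
     {a. Box a \<in> fst x} \<subseteq> fst y \<and> (\<forall>a. snd x = Some a \<longrightarrow> a \<notin> fst y)"
  by (simp_all add: canonical_def)

lemma acc_canonical_point: "(x, y) \<in> acc (canonical \<Lambda>) \<Longrightarrow> y \<in> points \<Lambda>"
  by simp

lemma point_prime: "x \<in> points \<Lambda> \<Longrightarrow> prime_theory \<Lambda> (fst x)"
  by (auto simp: points_def)

lemma point_closed: "x \<in> points \<Lambda> \<Longrightarrow> closed_theory \<Lambda> (fst x)"
  by (rule prime_theory_closed[OF point_prime])

lemma point_None: "prime_theory \<Lambda> G \<Longrightarrow> (G, None) \<in> points \<Lambda>"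
  by (simp add: points_def)

text \<open>No formula lies outside \<open>UNIV\<close>, so the inconsistent theory carries no
  omitted formula and the bomb is the only point over it; this makes the bomb strictly
  maximal.\<close>

lemma point_eq_bomb: "x \<in> points \<Lambda> \<Longrightarrow> fst x = UNIV \<longleftrightarrow> x = (UNIV, None)"
  by (cases x; cases "snd x") (auto simp: points_def)

lemma bot_in_point: "x \<in> points \<Lambda> \<Longrightarrow> Bot \<in> fst x \<longleftrightarrow> x = (UNIV, None)"
  by (simp add: bot_in_iff[OF point_closed] point_eq_bomb)

lemma or_in_point: "x \<in> points \<Lambda> \<Longrightarrow> Or a b \<in> fst x \<longleftrightarrow> a \<in> fst x \<or> b \<in> fst x"
  using point_prime or_in[OF point_closed] by (metis prime_theory_def)

lemma and_in_point: "x \<in> points \<Lambda> \<Longrightarrow> And a b \<in> fst x \<longleftrightarrow> a \<in> fst x \<and> b \<in> fst x"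
  by (rule and_in_iff[OF point_closed])

lemma CK_frame_canonical: "CK_frame (canonical \<Lambda>)"
proof -
  have "trans (leq (canonical \<Lambda>))"
    by (rule transI) (simp, blast)
  then have "preorder_on (points \<Lambda>) (leq (canonical \<Lambda>))"
    by (auto simp: preorder_on_def refl_on_def)
  moreover have "(UNIV, None) \<in> points \<Lambda>"
    by (intro point_None prime_theory_UNIV)
  moreover have "acc (canonical \<Lambda>) \<subseteq> points \<Lambda> \<times> points \<Lambda>"
    by auto
  moreover have "m = None" if "(UNIV, m) \<in> points \<Lambda>" for m
    using point_eq_bomb[OF that] by simp
  ultimately show ?thesis
    by (auto simp: CK_frame_def top_unique)
qed

section \<open>Truth lemma and completeness of the canonical frame\<close>

lemma imp_in_point:
  assumes x: "x \<in> points \<Lambda>"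
  shows "Imp a b \<in> fst x \<longleftrightarrow>
    (\<forall>y. (x, y) \<in> leq (canonical \<Lambda>) \<and> a \<in> fst y \<longrightarrow> b \<in> fst y)"
proof (intro iffI allI impI)
  fix y assume "Imp a b \<in> fst x" "(x, y) \<in> leq (canonical \<Lambda>) \<and> a \<in> fst y"
  then show "b \<in> fst y" using mp_in[OF point_closed, of y] by auto
next
  assume all: "\<forall>y. (x, y) \<in> leq (canonical \<Lambda>) \<and> a \<in> fst y \<longrightarrow> b \<in> fst y"
  show "Imp a b \<in> fst x"
  proof (rule ccontr)
    assume "Imp a b \<notin> fst x"
    then have "b \<notin> {b. Imp a b \<in> fst x}" by simp
    then obtain P where P: "prime_theory \<Lambda> P" "{b. Imp a b \<in> fst x} \<subseteq> P" "b \<notin> P"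
      by (rule prime_extension_omit[OF closed_theory_extend[OF point_closed[OF x]]])
    have "fst x \<subseteq> P" using P(2) imp_const_in[OF point_closed[OF x]] by blast
    moreover have "a \<in> P" using P(2) imp_refl_in[OF point_closed[OF x]] by blast
    ultimately show False using all[rule_format, of "(P, None)"] P x by (simp add: point_None)
  qed
qed

text \<open>The formula omitted at \<open>x\<close> would restrict its successors; moving up to
  \<open>(fst x, None)\<close>, which has the same theory, drops that restriction.\<close>

lemma unbox_reachable:
  assumes x: "x \<in> points \<Lambda>" and P: "prime_theory \<Lambda> P" and sub: "{a. Box a \<in> fst x} \<subseteq> P"
  shows "\<exists>y. (x, y) \<in> leq (canonical \<Lambda>) \<and> (y, (P, None)) \<in> acc (canonical \<Lambda>)"
  using assms by (intro exI[of _ "(fst x, None)"]) (simp add: point_None point_prime)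

lemma box_in_point:
  fixes a :: "'p form"
  assumes x: "x \<in> points \<Lambda>"
  shows "Box a \<in> fst x \<longleftrightarrow>
    (\<forall>y z. (x, y) \<in> leq (canonical \<Lambda>) \<and> (y, z) \<in> acc (canonical \<Lambda>) \<longrightarrow> a \<in> fst z)"
proof (intro iffI allI impI)
  assume all: "\<forall>y z. (x, y) \<in> leq (canonical \<Lambda>) \<and> (y, z) \<in> acc (canonical \<Lambda>) \<longrightarrow> a \<in> fst z"
  show "Box a \<in> fst x"
  proof (rule ccontr)
    assume "Box a \<notin> fst x"
    then have "a \<notin> {b. Box b \<in> fst x}" by simp
    then obtain P where P: "prime_theory \<Lambda> P" "{b. Box b \<in> fst x} \<subseteq> P" "a \<notin> P"
      by (rule prime_extension_omit[OF closed_theory_unbox[OF point_closed[OF x]]])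
    obtain y where "(x, y) \<in> leq (canonical \<Lambda>)" "(y, (P, None)) \<in> acc (canonical \<Lambda>)"
      using unbox_reachable[OF x P(1,2)] by blast
    then have "a \<in> fst (P, None :: 'p form option)" using all by blast
    then show False using P(3) by simp
  qed
qed auto

text \<open>Compactness of the set of successors of a canonical world.\<close>

lemma directed_dia_successor:
  assumes y: "y \<in> points \<Lambda>" and ne: "D \<noteq> {}"
    and dir: "\<And>a b. a \<in> D \<Longrightarrow> b \<in> D \<Longrightarrow>
      \<exists>c\<in>D. CK_theorem \<Lambda> (Imp c a) \<and> CK_theorem \<Lambda> (Imp c b)"
    and dia: "\<And>d. d \<in> D \<Longrightarrow> Dia d \<in> fst y"
  shows "\<exists>z. (y, z) \<in> acc (canonical \<Lambda>) \<and> D \<subseteq> fst z"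
proof (cases "snd y")
  \<comment> \<open>Without an omitted formula the bomb is a successor, and its theory contains
    everything.\<close>
  case None
  then show ?thesis
    using y by (intro exI[of _ "(UNIV, None)"]) (simp add: point_None prime_theory_UNIV)
next
  case (Some m)
  define B where "B = {a. Box a \<in> fst y}"
  have B: "closed_theory \<Lambda> B"
    unfolding B_def by (rule closed_theory_unbox[OF point_closed[OF y]])
  \<comment> \<open>The closed theory generated by \<open>B\<close> and \<open>D\<close>; one member
    of \<open>D\<close> suffices for each derivation because \<open>D\<close> is directed.\<close>
  define T where "T = {a. \<exists>d\<in>D. Imp d a \<in> B}"
  have ext: "closed_theory \<Lambda> {a. Imp d a \<in> B}" for d
    by (rule closed_theory_extend[OF B])
  have T: "closed_theory \<Lambda> T"
    unfolding closed_theory_def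
  proof (intro conjI allI impI)
    fix a assume "CK_theorem \<Lambda> a"
    then show "a \<in> T" using ne thm_in[OF ext] by (auto simp: T_def)
  next
    fix a b assume "Imp a b \<in> T" "a \<in> T"
    then obtain d e where de: "d \<in> D" "Imp d (Imp a b) \<in> B" "e \<in> D" "Imp e a \<in> B"
      by (auto simp: T_def)
    then obtain c where c: "c \<in> D" "CK_theorem \<Lambda> (Imp c d)" "CK_theorem \<Lambda> (Imp c e)"
      using dir by blast
    have "Imp d (Imp a b) \<in> {a. Imp c a \<in> B}" "Imp e a \<in> {a. Imp c a \<in> B}"
      "d \<in> {a. Imp c a \<in> B}" "e \<in> {a. Imp c a \<in> B}"
      using imp_const_in[OF B] de thm_in[OF B] c by auto
    then have "b \<in> {a. Imp c a \<in> B}" using mp_in[OF ext] by blast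
    then show "b \<in> T" using c(1) by (auto simp: T_def)
  qed
  \<comment> \<open>Otherwise \<open>Box (Imp d m)\<close> and \<open>Dia d\<close> would put
    \<open>Dia m\<close> in \<open>fst y\<close>, against the condition on points that omit
    \<open>m\<close>.\<close>
  have "m \<notin> T"
  proof
    assume "m \<in> T"
    then have "Dia m \<in> fst y"
      using dia_mono_in[OF point_closed[OF y]] dia by (auto simp: T_def B_def)
    then show False using y Some by (auto simp: points_def)
  qed
  then obtain P where P: "prime_theory \<Lambda> P" "T \<subseteq> P" "m \<notin> P"
    by (rule prime_extension_omit[OF T])
  have "B \<subseteq> P" using P(2) ne imp_const_in[OF B] by (fastforce simp: T_def)
  moreover have "D \<subseteq> P" using P(2) imp_refl_in[OF B] by (auto simp: T_def)
  ultimately show ?thesis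
    using P y Some by (intro exI[of _ "(P, None)"]) (simp add: point_None B_def)
qed

lemma dia_in_point:
  assumes x: "x \<in> points \<Lambda>"
  shows "Dia a \<in> fst x \<longleftrightarrow>
    (\<forall>y. (x, y) \<in> leq (canonical \<Lambda>) \<longrightarrow> (\<exists>z. (y, z) \<in> acc (canonical \<Lambda>) \<and> a \<in> fst z))"
proof (intro iffI allI impI)
  fix y assume "Dia a \<in> fst x" "(x, y) \<in> leq (canonical \<Lambda>)"
  then show "\<exists>z. (y, z) \<in> acc (canonical \<Lambda>) \<and> a \<in> fst z"
    using directed_dia_successor[of y \<Lambda> "{a}"] CK_theorem_impI[of \<Lambda> a a] by auto
next
  assume all: "\<forall>y. (x, y) \<in> leq (canonical \<Lambda>) \<longrightarrow>
    (\<exists>z. (y, z) \<in> acc (canonical \<Lambda>) \<and> a \<in> fst z)"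
  show "Dia a \<in> fst x"
  proof (rule ccontr)
    assume "Dia a \<notin> fst x"
    \<comment> \<open>The point over the same theory that omits \<open>a\<close> lies above
      \<open>x\<close> and has no successor containing \<open>a\<close>.\<close>
    then have "(fst x, Some a) \<in> points \<Lambda>" using point_prime[OF x] by (simp add: points_def)
    then show False using all[rule_format, of "(fst x, Some a)"] x by auto
  qed
qed

lemma truth_canonical:
  "truth (canonical \<Lambda>) (\<lambda>p. {x \<in> points \<Lambda>. Atom p \<in> fst x}) a = {x \<in> points \<Lambda>. a \<in> fst x}"
proof (induction a)
  case Bot
  have "(UNIV, None) \<in> points \<Lambda>" by (intro point_None prime_theory_UNIV)
  then show ?case using bot_in_point by auto
next
  case (And a b)
  then show ?case using and_in_point by simp blast
next
  case (Or a b)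
  then show ?case using or_in_point by simp blast
next
  case (Imp a b)
  have "truth (canonical \<Lambda>) (\<lambda>p. {x \<in> points \<Lambda>. Atom p \<in> fst x}) (Imp a b) =
    {x \<in> points \<Lambda>. \<forall>y. (x, y) \<in> leq (canonical \<Lambda>) \<and> a \<in> fst y \<longrightarrow> b \<in> fst y}"
    unfolding truth.simps Imp.IH canonical_simps(1) using canonical_simps(3) by blast
  then show ?case using imp_in_point by blast
next
  case (Box a)
  have "truth (canonical \<Lambda>) (\<lambda>p. {x \<in> points \<Lambda>. Atom p \<in> fst x}) (Box a) =
    {x \<in> points \<Lambda>. \<forall>y z. (x, y) \<in> leq (canonical \<Lambda>) \<and> (y, z) \<in> acc (canonical \<Lambda>)
       \<longrightarrow> a \<in> fst z}"
    unfolding truth.simps Box.IH canonical_simps(1) using acc_canonical_point by blast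
  then show ?case using box_in_point by blast
next
  case (Dia a)
  have "truth (canonical \<Lambda>) (\<lambda>p. {x \<in> points \<Lambda>. Atom p \<in> fst x}) (Dia a) =
    {x \<in> points \<Lambda>. \<forall>y. (x, y) \<in> leq (canonical \<Lambda>) \<longrightarrow>
       (\<exists>z. (y, z) \<in> acc (canonical \<Lambda>) \<and> a \<in> fst z)}"
    unfolding truth.simps Dia.IH canonical_simps(1) using acc_canonical_point by blast
  then show ?case using dia_in_point by blast
qed simp

lemma canonical_complete:
  assumes "valid (canonical \<Lambda>) a"
  shows "CK_theorem \<Lambda> a"
proof (rule ccontr)
  assume "\<not> CK_theorem \<Lambda> a"
  then have "a \<notin> {a. CK_theorem \<Lambda> a}" by simp
  then obtain P where P: "prime_theory \<Lambda> P" "a \<notin> P"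
    by (rule prime_extension_omit[OF closed_theory_theorems])
  have "valuation (canonical \<Lambda>) (\<lambda>p. {x \<in> points \<Lambda>. Atom p \<in> fst x})"
    using point_None[OF prime_theory_UNIV[of \<Lambda>]] by (auto simp: valuation_def Up_def)
  then have "truth (canonical \<Lambda>) (\<lambda>p. {x \<in> points \<Lambda>. Atom p \<in> fst x}) a = points \<Lambda>"
    using assms[unfolded valid_def] by simp
  then have "{x \<in> points \<Lambda>. a \<in> fst x} = points \<Lambda>"
    by (simp only: truth_canonical)
  then have "(P, None) \<in> {x \<in> points \<Lambda>. a \<in> fst x}"
    using point_None[OF P(1)] by (simp only:)
  then show False using P(2) by simp
qed


section \<open>Canonicity of Sahlqvist formulas\<close>

lemma truth_mono_positive:
  assumes "positive a" and "\<And>p. V p \<subseteq> W p"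
  shows "truth X V a \<subseteq> truth X W a"
  using assms(1)
proof (induction rule: positive.induct)
  case (1 p)
  then show ?case using assms(2) by simp
next
  case (6 a)
  then show ?case by (auto 0 4)
next
  case (7 a)
  then show ?case by (auto 0 4)
qed auto

text \<open>The instances of \<open>a\<close> form a downward directed family:
  \<open>\<lambda>p. And (s p) (t p)\<close> is admissible when \<open>s\<close> and
  \<open>t\<close> are, and positive formulas are monotone under substitution. Hence the quantifier
  over \<open>s\<close> can be moved inside a disjunction by primeness, and inside a diamond by
  compactness of the successors.\<close>

lemma truth_closed_valuation:
  assumes T: "\<And>p. closed_theory \<Lambda> (T p)" and "positive a" and "x \<in> points \<Lambda>"
  shows "x \<in> truth (canonical \<Lambda>) (\<lambda>p. {x \<in> points \<Lambda>. T p \<subseteq> fst x}) a \<longleftrightarrow>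
    (\<forall>s. (\<forall>p. s p \<in> T p) \<longrightarrow> subst s a \<in> fst x)"
  using assms(2,3)
proof (induction a arbitrary: x rule: positive.induct)
  case (1 p)
  \<comment> \<open>\<open>Top\<close> serves as the value at all other variables, since it belongs
    to every closed theory.\<close>
  have "\<exists>s. (\<forall>q. s q \<in> T q) \<and> s p = b" if "b \<in> T p" for b
    using that imp_refl_in[OF T, of Bot]
    by (intro exI[of _ "\<lambda>q. if q = p then b else Top"]) auto
  then show ?case using 1 by auto
next
  case 2
  then show ?case using imp_refl_in[OF point_closed[OF 2]] by auto
next
  case 3
  \<comment> \<open>The constant substitution by \<open>Top\<close> is admissible, so the right-hand
    side is not vacuous.\<close>
  have "\<forall>p. Top \<in> T p" using imp_refl_in[OF T] by blast
  then have "\<exists>s. \<forall>p. s p \<in> T p" by (intro exI[of _ "\<lambda>_. Top"])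
  then show ?case using bot_in_point[OF 3] by auto
next
  case (4 a b)
  then show ?case using and_in_point[OF 4(5)] by auto
next
  case (5 a b)
  have "(\<forall>s. (\<forall>p. s p \<in> T p) \<longrightarrow> subst s a \<in> fst x) \<or>
        (\<forall>s. (\<forall>p. s p \<in> T p) \<longrightarrow> subst s b \<in> fst x)"
    if all: "\<forall>s. (\<forall>p. s p \<in> T p) \<longrightarrow> Or (subst s a) (subst s b) \<in> fst x"
  proof (rule ccontr)
    assume "\<not> ?thesis"
    then obtain s t where st: "\<forall>p. s p \<in> T p" "subst s a \<notin> fst x"
      "\<forall>p. t p \<in> T p" "subst t b \<notin> fst x" by blast
    define u where "u = (\<lambda>p. And (s p) (t p))"
    have "\<forall>p. u p \<in> T p" using st and_in_iff[OF T] by (simp add: u_def)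
    then have "subst u a \<in> fst x \<or> subst u b \<in> fst x"
      using all or_in_point[OF 5(5)] by blast
    moreover have "CK_theorem \<Lambda> (Imp (u p) (s p))" "CK_theorem \<Lambda> (Imp (u p) (t p))" for p
      by (auto simp: u_def intro: CK_theorem.IPC AndE1 AndE2)
    ultimately show False
      using subst_mono_positive[OF 5(1) _ point_closed[OF 5(5)], of u s]
        subst_mono_positive[OF 5(2) _ point_closed[OF 5(5)], of u t] st by blast
  qed
  then show ?case using 5 or_in_point[OF 5(5)] by auto
next
  case (6 a)
  have "x \<in> truth (canonical \<Lambda>) (\<lambda>p. {x \<in> points \<Lambda>. T p \<subseteq> fst x}) (Box a) \<longleftrightarrow>
    (\<forall>y z. (x, y) \<in> leq (canonical \<Lambda>) \<and> (y, z) \<in> acc (canonical \<Lambda>) \<longrightarrow>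
       (\<forall>s. (\<forall>p. s p \<in> T p) \<longrightarrow> subst s a \<in> fst z))"
    unfolding truth.simps canonical_simps(1) using 6(2,3) acc_canonical_point by blast
  also have "\<dots> \<longleftrightarrow> (\<forall>s. (\<forall>p. s p \<in> T p) \<longrightarrow> Box (subst s a) \<in> fst x)"
    unfolding box_in_point[OF 6(3)] by blast
  finally show ?case by simp
next
  case (7 a)
  define D where "D = {subst s a | s. \<forall>p. s p \<in> T p}"
  have D_iff: "D \<subseteq> fst z \<longleftrightarrow> (\<forall>s. (\<forall>p. s p \<in> T p) \<longrightarrow> subst s a \<in> fst z)" for z :: "'a point"
    by (auto simp: D_def)
  have "\<forall>p. Top \<in> T p" using imp_refl_in[OF T] by blast
  then have ne: "D \<noteq> {}" by (auto simp: D_def intro: exI[of _ "\<lambda>_. Top"])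
  have dir: "\<exists>c\<in>D. CK_theorem \<Lambda> (Imp c d) \<and> CK_theorem \<Lambda> (Imp c e)"
    if "d \<in> D" "e \<in> D" for d e
  proof -
    obtain s t where st: "\<forall>p. s p \<in> T p" "d = subst s a" "\<forall>p. t p \<in> T p" "e = subst t a"
      using \<open>d \<in> D\<close> \<open>e \<in> D\<close> by (auto simp: D_def)
    define u where "u = (\<lambda>p. And (s p) (t p))"
    have "\<forall>p. u p \<in> T p" using st and_in_iff[OF T] by (simp add: u_def)
    then have "subst u a \<in> D" by (auto simp: D_def)
    moreover have us: "CK_theorem \<Lambda> (Imp (u p) (s p))"
      and ut: "CK_theorem \<Lambda> (Imp (u p) (t p))" for p
      by (auto simp: u_def intro: CK_theorem.IPC AndE1 AndE2)
    have "CK_theorem \<Lambda> (Imp (subst u a) d)" "CK_theorem \<Lambda> (Imp (subst u a) e)"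
      unfolding st(2,4)
      by (rule CK_theorem_impI, erule (1) subst_mono_positive[OF 7(1) us]
          subst_mono_positive[OF 7(1) ut])+
    ultimately show ?thesis by blast
  qed
  have "x \<in> truth (canonical \<Lambda>) (\<lambda>p. {x \<in> points \<Lambda>. T p \<subseteq> fst x}) (Dia a) \<longleftrightarrow>
    (\<forall>y. (x, y) \<in> leq (canonical \<Lambda>) \<longrightarrow> (\<exists>z. (y, z) \<in> acc (canonical \<Lambda>) \<and> D \<subseteq> fst z))"
    unfolding truth.simps D_iff canonical_simps(1) using 7(2,3) acc_canonical_point by blast
  also have "\<dots> \<longleftrightarrow> (\<forall>d\<in>D. Dia d \<in> fst x)"
  proof
    assume "\<forall>y. (x, y) \<in> leq (canonical \<Lambda>) \<longrightarrow> (\<exists>z. (y, z) \<in> acc (canonical \<Lambda>) \<and> D \<subseteq> fst z)"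
    then show "\<forall>d\<in>D. Dia d \<in> fst x" unfolding dia_in_point[OF 7(3)] by blast
  next
    \<comment> \<open>Compactness is used here: one successor has to contain all of \<open>D\<close>
      at once, not a different one for each \<open>d\<close>.\<close>
    assume "\<forall>d\<in>D. Dia d \<in> fst x"
    then show "\<forall>y. (x, y) \<in> leq (canonical \<Lambda>) \<longrightarrow>
        (\<exists>z. (y, z) \<in> acc (canonical \<Lambda>) \<and> D \<subseteq> fst z)"
      using directed_dia_successor[OF _ ne dir] unfolding canonical_simps(3) by blast
  qed
  also have "\<dots> \<longleftrightarrow> (\<forall>s. (\<forall>p. s p \<in> T p) \<longrightarrow> subst s (Dia a) \<in> fst x)"
    by (auto simp: D_def)
  finally show ?case .
qed

text \<open>The inclusion of theories is realised by an actual path: alternating steps up the order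
  and along accessibility lead from \<open>x\<close>, after \<open>n\<close> rounds, to a point
  whose theory is contained in that of \<open>z\<close>, and \<open>V p\<close> is an upset.\<close>

lemma boxed_atom_minimal:
  fixes \<Lambda> :: "'p form set" and p :: 'p
  assumes V: "valuation (canonical \<Lambda>) V"
    and "x \<in> points \<Lambda>" and "x \<in> truth (canonical \<Lambda>) V ((Box ^^ n) (Atom p))"
    and z: "z \<in> points \<Lambda>" and "{a. (Box ^^ n) a \<in> fst x} \<subseteq> fst z"
  shows "z \<in> V p"
  using assms(2,3,5)
proof (induction n arbitrary: x)
  case 0
  then have "(x, z) \<in> leq (canonical \<Lambda>)" "x \<in> V p" using z by auto
  then show ?case using V unfolding valuation_def Up_def by blast
next
  case (Suc n)
  \<comment> \<open>Avoiding \<open>I\<close> means that \<open>(Box ^^ n) a \<in> P\<close> only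
    for \<open>a \<in> fst z\<close>, which is the inclusion the induction hypothesis asks for.
    \<open>I\<close> is directed because \<open>z\<close> is prime and boxes are monotone.\<close>
  define I where "I = {(Box ^^ n) a | a. a \<notin> fst z}"
  have "{a. Box a \<in> fst x} \<inter> I = {}" using Suc.prems(3) by (auto simp: I_def)
  moreover have "\<exists>e\<in>I. CK_theorem \<Lambda> (Imp c e) \<and> CK_theorem \<Lambda> (Imp d e)"
    if cd: "c \<in> I" "d \<in> I" for c d
  proof -
    obtain a b where ab: "c = (Box ^^ n) a" "a \<notin> fst z" "d = (Box ^^ n) b" "b \<notin> fst z"
      using cd by (auto simp: I_def)
    then have "(Box ^^ n) (Or a b) \<in> I" using or_in_point[OF z] by (auto simp: I_def)
    then show ?thesis
      using ab box_pow_mono[OF CK_theorem.IPC[OF OrI1]] box_pow_mono[OF CK_theorem.IPC[OF OrI2]] by blast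
  qed
  ultimately obtain P where P: "prime_theory \<Lambda> P" "{a. Box a \<in> fst x} \<subseteq> P" "P \<inter> I = {}"
    by (rule prime_extension[OF closed_theory_unbox[OF point_closed[OF Suc.prems(1)]]])
  obtain y where "(x, y) \<in> leq (canonical \<Lambda>)" "(y, (P, None)) \<in> acc (canonical \<Lambda>)"
    using unbox_reachable[OF Suc.prems(1) P(1,2)] by blast
  then have "(P, None) \<in> truth (canonical \<Lambda>) V ((Box ^^ n) (Atom p))"
    using Suc.prems(2) unfolding funpow.simps comp_apply truth.simps by blast
  moreover have "{a. (Box ^^ n) a \<in> fst (P, None :: 'p form option)} \<subseteq> fst z" using P(3) by (auto simp: I_def)
  ultimately show ?case by (rule Suc.IH[OF point_None[OF P(1)]])
qed

lemma subst_box_pow: "subst s ((Box ^^ n) a) = (Box ^^ n) (subst s a)"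
  by (induction n) auto

text \<open>The minimal valuation of Sahlqvist's method: a boxed atom asks its variable to hold only
  at points over the \<open>n\<close>-fold unboxing of \<open>fst x\<close>, a conjunction takes the
  union of two closed valuations, and a disjunction keeps that of a true disjunct.\<close>

lemma antecedent_closed_valuation:
  assumes V: "valuation (canonical \<Lambda>) V" and x: "x \<in> points \<Lambda>"
    and "sahlqvist_antecedent a" and "x \<in> truth (canonical \<Lambda>) V a"
  shows "\<exists>T. (\<forall>p. closed_theory \<Lambda> (T p)) \<and> (\<forall>p. {z \<in> points \<Lambda>. T p \<subseteq> fst z} \<subseteq> V p) \<and>
    (\<forall>s. (\<forall>p. s p \<in> T p) \<longrightarrow> subst s a \<in> fst x)"
proof -
  \<comment> \<open>The theory \<open>UNIV\<close> encodes the least upset, the bomb alone; it is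
    the value for variables under no constraint.\<close>
  have bomb: "{z \<in> points \<Lambda>. UNIV \<subseteq> fst z} \<subseteq> V p" for p
    using V point_eq_bomb by (fastforce simp: valuation_def Up_def top_unique)
  show ?thesis
    using assms(3,4)
  proof (induction rule: sahlqvist_antecedent.induct[case_names boxed_atom Top Bot And Or])
    case (boxed_atom n q)
    let ?T = "\<lambda>p. if p = q then {a. (Box ^^ n) a \<in> fst x} else UNIV"
    have "z \<in> V q" if "z \<in> points \<Lambda>" "{a. (Box ^^ n) a \<in> fst x} \<subseteq> fst z" for z
      by (rule boxed_atom_minimal[OF V x boxed_atom that])
    then show ?case
      using bomb closed_theory_unbox_pow[OF point_closed[OF x], of n]
      by (intro exI[of _ ?T]) (auto simp: subst_box_pow closed_theory_UNIV)
  next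
    case Top
    then show ?case
      using bomb imp_refl_in[OF point_closed[OF x]] closed_theory_UNIV
      by (intro exI[of _ "\<lambda>_. UNIV"]) auto
  next
    case Bot
    then show ?case
      using bomb closed_theory_UNIV by (intro exI[of _ "\<lambda>_. UNIV"]) auto
  next
    case (And a b)
    then obtain S T where S: "\<forall>p. closed_theory \<Lambda> (S p)"
        "\<forall>p. {z \<in> points \<Lambda>. S p \<subseteq> fst z} \<subseteq> V p"
        "\<forall>s. (\<forall>p. s p \<in> S p) \<longrightarrow> subst s a \<in> fst x"
      and T: "\<forall>p. closed_theory \<Lambda> (T p)" "\<forall>p. {z \<in> points \<Lambda>. T p \<subseteq> fst z} \<subseteq> V p"
        "\<forall>s. (\<forall>p. s p \<in> T p) \<longrightarrow> subst s b \<in> fst x" by auto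
    \<comment> \<open>Unions of closed sets correspond to intersections of theories because points
      are prime: two formulas missing from \<open>fst z\<close> have a missing disjunction.\<close>
    have "S p \<subseteq> fst z \<or> T p \<subseteq> fst z" if z: "z \<in> points \<Lambda>" and sub: "S p \<inter> T p \<subseteq> fst z" for p z
    proof (rule ccontr)
      assume "\<not> ?thesis"
      then obtain c d where "c \<in> S p" "c \<notin> fst z" "d \<in> T p" "d \<notin> fst z" by blast
      then show False
        using or_in[of \<Lambda> "S p" c d] or_in[of \<Lambda> "T p" c d] S(1) T(1) sub or_in_point[OF z, of c d]
        by blast
    qed
    then have "\<forall>p. {z \<in> points \<Lambda>. S p \<inter> T p \<subseteq> fst z} \<subseteq> V p" using S(2) T(2) by blast
    moreover have "\<forall>p. closed_theory \<Lambda> (S p \<inter> T p)" using S(1) T(1) closed_theory_Int by blast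
    ultimately show ?case
      using S(3) T(3) and_in_point[OF x]
      by (intro exI[of _ "\<lambda>p. S p \<inter> T p"]) auto
  next
    case (Or a b)
    then show ?case using or_in_point[OF x] by simp blast
  qed
qed

theorem sahlqvist_canonical:
  assumes "sahlqvist l" and l: "l \<in> \<Lambda>"
  shows "valid (canonical \<Lambda>) l"
proof -
  obtain a b where ab: "l = Imp a b" "sahlqvist_antecedent a" "positive b"
    using assms(1) by (auto simp: sahlqvist_def)
  have "x \<in> truth (canonical \<Lambda>) V b"
    if V: "valuation (canonical \<Lambda>) V" and x: "x \<in> points \<Lambda>" "x \<in> truth (canonical \<Lambda>) V a" for V x
  proof -
    obtain T where T: "\<And>p. closed_theory \<Lambda> (T p)" "\<And>p. {z \<in> points \<Lambda>. T p \<subseteq> fst z} \<subseteq> V p"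
      "\<And>s. (\<forall>p. s p \<in> T p) \<Longrightarrow> subst s a \<in> fst x"
      using antecedent_closed_valuation[OF V x(1) ab(2) x(2)] by blast
    \<comment> \<open>Every substitution instance of \<open>l\<close> is an axiom, so the admissible
      instances of \<open>a\<close> in \<open>fst x\<close> yield those of \<open>b\<close>.\<close>
    have "subst s b \<in> fst x" if s: "\<forall>p. s p \<in> T p" for s
    proof (rule mp_in[OF point_closed[OF x(1)] _ T(3)[OF s]])
      show "Imp (subst s a) (subst s b) \<in> fst x"
        using thm_in[OF point_closed[OF x(1)] CK_theorem.Ax[OF l, of s]] ab(1) by simp
    qed
    then have "x \<in> truth (canonical \<Lambda>) (\<lambda>p. {z \<in> points \<Lambda>. T p \<subseteq> fst z}) b"
      using truth_closed_valuation[OF T(1) ab(3) x(1)] by simp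
    then show ?thesis by (rule subsetD[OF truth_mono_positive[OF ab(3) T(2)], rotated])
  qed
  then show ?thesis unfolding valid_def ab(1) truth.simps canonical_simps(1,3) by blast
qed


section \<open>Transport to another universe\<close>

text \<open>The class \<open>\<K>\<close> contains only frames over the type \<open>'w\<close>, so
  the canonical frame has to be copied into \<open>'w\<close> along an injection.\<close>

definition map_frame :: "('v \<Rightarrow> 'w) \<Rightarrow> 'v frame \<Rightarrow> 'w frame" where
  "map_frame g X = \<lparr>worlds = g ` worlds X, bomb = g (bomb X),
     leq = map_prod g g ` leq X, acc = map_prod g g ` acc X\<rparr>"

context
  fixes g :: "'v \<Rightarrow> 'w" and X :: "'v frame"
  assumes g: "inj g" and X: "CK_frame X"
begin

lemma map_frame_simps:
  "worlds (map_frame g X) = g ` worlds X"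
  "bomb (map_frame g X) = g (bomb X)"
  "(u, v) \<in> leq (map_frame g X) \<longleftrightarrow> (\<exists>x y. u = g x \<and> v = g y \<and> (x, y) \<in> leq X)"
  "(u, v) \<in> acc (map_frame g X) \<longleftrightarrow> (\<exists>x y. u = g x \<and> v = g y \<and> (x, y) \<in> acc X)"
  by (auto simp: map_frame_def)

lemma CK_frame_map_frame: "CK_frame (map_frame g X)"
proof -
  have pre: "preorder_on (worlds X) (leq X)" using X by (simp add: CK_frame_def)
  have "trans (leq (map_frame g X))"
  proof (rule transI)
    fix u v w assume "(u, v) \<in> leq (map_frame g X)" "(v, w) \<in> leq (map_frame g X)"
    then show "(u, w) \<in> leq (map_frame g X)"
      using pre g unfolding map_frame_simps preorder_on_def by (metis injD transD)
  qed
  then have "preorder_on (worlds (map_frame g X)) (leq (map_frame g X))"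
    using pre by (auto simp: preorder_on_def refl_on_def map_frame_def)
  moreover have "acc (map_frame g X) \<subseteq> worlds (map_frame g X) \<times> worlds (map_frame g X)"
    using X by (fastforce simp: CK_frame_def map_frame_def)
  ultimately show ?thesis
    using X by (simp add: CK_frame_def map_frame_simps) (auto simp: inj_eq[OF g])
qed

lemma truth_map_frame: "truth (map_frame g X) (\<lambda>p. g ` V p) a = g ` truth X V a"
proof (induction a)
  case (And a b)
  then show ?case by (simp add: image_Int[OF g])
next
  case (Imp a b)
  then show ?case by (fastforce simp: map_frame_simps inj_eq[OF g] inj_image_mem_iff[OF g])
next
  case (Box a)
  then show ?case by (fastforce simp: map_frame_simps inj_eq[OF g] inj_image_mem_iff[OF g])
next
  case (Dia a)
  then show ?case by (fastforce simp: map_frame_simps inj_eq[OF g] inj_image_mem_iff[OF g])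
qed (auto simp: map_frame_simps)

text \<open>A valuation of the copy takes values inside the image of \<open>worlds X\<close>, so its
  preimages under \<open>g\<close> recover it.\<close>

lemma valuation_map_frame:
  "valuation (map_frame g X) W \<longleftrightarrow> (\<exists>V. valuation X V \<and> W = (\<lambda>p. g ` V p))"
proof
  assume W: "valuation (map_frame g X) W"
  have sub: "W p \<subseteq> g ` worlds X" and bomb: "g (bomb X) \<in> W p"
    and up: "g x \<in> W p \<Longrightarrow> (x, y) \<in> leq X \<Longrightarrow> g y \<in> W p" for p x y
    using W unfolding valuation_def Up_def map_frame_simps by blast+
  have "W p = g ` (g -` W p)" for p
    using sub by blast
  moreover have "g -` W p \<subseteq> worlds X" for p
    using sub g by (fastforce simp: inj_eq)
  then have "valuation X (\<lambda>p. g -` W p)"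
    using bomb up by (simp add: valuation_def Up_def)
  ultimately show "\<exists>V. valuation X V \<and> W = (\<lambda>p. g ` V p)" by blast
next
  assume "\<exists>V. valuation X V \<and> W = (\<lambda>p. g ` V p)"
  then show "valuation (map_frame g X) W"
    by (fastforce simp: valuation_def Up_def map_frame_simps inj_eq[OF g])
qed

lemma valid_map_frame: "valid (map_frame g X) a \<longleftrightarrow> valid X a"
  by (auto simp: valid_def valuation_map_frame truth_map_frame map_frame_simps(1)
      inj_image_eq_iff[OF g])

end

text \<open>\<open>Bot\<close> serves as a tag: formulas are prefixed with \<open>Box\<close>, so
  the only member of the code that contains \<open>Bot\<close> encodes the theory, and a further
  singleton, if present, encodes the omitted formula.\<close>

lemma point_embedding: "\<exists>h :: 'p point \<Rightarrow> 'p form set set. inj h"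
proof
  let ?h = "\<lambda>(G :: 'p form set, m :: 'p form option).
    insert (insert Bot (Box ` G)) (case m of None \<Rightarrow> {} | Some a \<Rightarrow> {{Box a}})"
  show "inj ?h"
  proof (rule injI)
    fix x y :: "'p point"
    assume "?h x = ?h y"
    moreover obtain G m H n where xy: "x = (G, m)" "y = (H, n)"
      by (cases x, cases y)
    ultimately have eq: "?h (G, m) = ?h (H, n)" by (simp only:)
    have code: "{A \<in> ?h (G, m). Bot \<in> A} = {insert Bot (Box ` G)}"
      "{A \<in> ?h (G, m). Bot \<notin> A} = (case m of None \<Rightarrow> {} | Some a \<Rightarrow> {{Box a}})"
      for G :: "'p form set" and m :: "'p form option"
      by (auto split: option.splits)
    have "insert Bot (Box ` G) = insert Bot (Box ` H)"
      using code(1)[of G m] code(1)[of H n] unfolding eq by simp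
    moreover have "Box ` G = insert Bot (Box ` G) - {Bot}" for G :: "'p form set" by auto
    ultimately have "Box ` G = Box ` H" by metis
    then have "G = H" by (subst (asm) inj_image_eq_iff) (auto simp: inj_def)
    moreover have "m = n"
      using code(2)[of G m] code(2)[of H n] unfolding eq by (auto split: option.splits)
    ultimately show "x = y" using xy by simp
  qed
qed

theorem theorem4p24:
  fixes \<Lambda> :: "'p form set" and \<alpha> :: "'p form \<Rightarrow> fo_form"
    and \<K> :: "'w frame set" and \<phi> :: "'p form"
  assumes universe: "large_universe TYPE('w) TYPE('p)"
    and sahlqvist: "\<forall>l\<in>\<Lambda>. sahlqvist l"
    and correspondent: "\<forall>l\<in>\<Lambda>. fo_correspondent TYPE('w) l (\<alpha> l)"
    and class_def: "\<K> = {X. CK_frame X \<and> (\<forall>l\<in>\<Lambda>. satisfies X (\<alpha> l))}"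
    and valid: "\<forall>X\<in>\<K>. valid X \<phi>"
  shows "CK_theorem \<Lambda> \<phi>"
proof -
  obtain f :: "'p form set set \<Rightarrow> 'w" where "inj f"
    using universe by (auto simp: large_universe_def)
  moreover obtain h :: "'p point \<Rightarrow> 'p form set set" where "inj h"
    using point_embedding by blast
  ultimately have g: "inj (f \<circ> h)" by (rule inj_compose)
  let ?X = "map_frame (f \<circ> h) (canonical \<Lambda>)"
  have X: "CK_frame ?X" by (rule CK_frame_map_frame[OF g CK_frame_canonical])
  have "valid ?X l" if "l \<in> \<Lambda>" for l
    using sahlqvist_canonical[of l \<Lambda>] that sahlqvist
    by (simp add: valid_map_frame[OF g CK_frame_canonical])
  \<comment> \<open>The correspondents enter here, at the single frame \<open>?X\<close>: validity
    of each \<open>l\<close> on it becomes satisfaction of \<open>\<alpha> l\<close>.\<close>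
  then have "?X \<in> \<K>"
    using X correspondent by (simp add: class_def fo_correspondent_def)
  then have "valid (canonical \<Lambda>) \<phi>"
    using valid valid_map_frame[OF g CK_frame_canonical] by blast
  then show ?thesis by (rule canonical_complete)
qed

end
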